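(* Let $x\in\mathbb N$ and let $u,A,c:\mathbb N\times[0,1]\to[0,\infty)$ and $b:\mathbb N\to[0,\infty)$ be functions (with $u(k,\cdot),A(k,\cdot),c(k,\cdot)$ measurable so that the integrals below make sense) such that for all integers $k\ge x$ and all $\tau\in(0,1]$ $$u(k,\tau)\le A(k,\tau)+b(k)\int_\tau^1\sum_{l=x}^{k-1}c(l,\tau')u(l,\tau')\,d\tau'.$$ Then for all integers $k\ge x$ and all $\tau\in(0,1]$ $$u(k,\tau)\le A(k,\tau)+b(k)\int_\tau^1\sum_{l=x}^{k-1}c(l,\tau')A(l,\tau')\prod_{j=l+1}^{k-1}\bigg(1+\int_\tau^{\tau'}b(j)c(j,\tau'')\,d\tau''\bigg)d\tau'.$$
   Context: Empty sums are $0$ and empty products are $1$. *)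

theory Defs
  imports "HOL-Analysis.Analysis"
begin

end

theory Submission
  imports Defs
begin

text \<open>
  Strong induction on \<open>k\<close>: inserting the claimed bound for all \<open>l < k\<close> into the recursive bound
  and exchanging the order of integration leaves, as the weight of each \<open>c(m,s) A(m,s)\<close>, the sum
  \<open>1 + (\<Sum>l=m+1..<k. B\<^sub>l * (\<Prod>j=m+1..<l. 1 + B\<^sub>j))\<close> with \<open>B\<^sub>j\<close> the integral of \<open>b(j) c(j,\<cdot>)\<close> over
  \<open>[\<tau>, s]\<close>. This sum telescopes to the product \<open>\<Prod>j=m+1..<k. 1 + B\<^sub>j\<close>.
\<close>

text \<open>Passing from \<open>k\<close> to \<open>Suc k\<close> adds \<open>B k\<close> times the
  product so far, which amounts to multiplying that product by \<open>1 + B k\<close>. A semiring is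
  assumed because the identity is applied in \<open>ennreal\<close>, where terms cannot be moved
  across by subtraction.\<close>

lemma one_plus_sum_prod_telescope:
  fixes B :: "nat \<Rightarrow> 'a::comm_semiring_1"
  assumes "n \<le> k"
  shows "1 + (\<Sum>l=n..<k. B l * (\<Prod>j=n..<l. 1 + B j)) = (\<Prod>j=n..<k. 1 + B j)"
  using assms
proof (induction k rule: dec_induct)
  case base
  then show ?case by simp
next
  case (step k)
  have "1 + (\<Sum>l=n..<Suc k. B l * (\<Prod>j=n..<l. 1 + B j)) =
      (1 + (\<Sum>l=n..<k. B l * (\<Prod>j=n..<l. 1 + B j))) + B k * (\<Prod>j=n..<k. 1 + B j)"
    using step.hyps by (simp add: add.assoc)
  also have "\<dots> = (\<Prod>j=n..<Suc k. 1 + B j)"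
    unfolding step.IH using step.hyps by (simp add: distrib_right mult.commute)
  finally show ?case .
qed

lemma sum_nested_swap_less:
  fixes f :: "nat \<Rightarrow> nat \<Rightarrow> 'a::comm_monoid_add"
  shows "(\<Sum>l=x..<k. \<Sum>m=x..<l. f l m) = (\<Sum>m=x..<k. \<Sum>l=m+1..<k. f l m)"
  unfolding sum.Sigma[OF finite_atLeastLessThan ballI[OF finite_atLeastLessThan]]
  by (rule sum.reindex_bij_witness[of _ "\<lambda>(m, l). (l, m)" "\<lambda>(l, m). (m, l)"]) auto

text \<open>The sigma-algebra of \<open>M\<close> may be finer than the Borel one, as for Lebesgue
  measure. Borel measurability of the coordinates is what makes conditions such as t <= s measurable
  on the product space.\<close>

lemma borel_measurable_pair_coordinates:
  assumes "(\<lambda>t. t) \<in> borel_measurable M"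
  shows "fst \<in> borel_measurable (M \<Otimes>\<^sub>M M)" "snd \<in> borel_measurable (M \<Otimes>\<^sub>M M)"
  using measurable_compose[OF measurable_fst[of M M] assms]
    measurable_compose[OF measurable_snd[of M M] assms] by simp_all

text \<open>Both sides integrate f(t) g(s) over the triangle a <= t <= s, so this is Tonelli's
  theorem. It needs \<open>g\<close> to be free of the outer variable t.\<close>

lemma nn_integral_triangle_swap:
  fixes M :: "real measure" and f g :: "real \<Rightarrow> ennreal"
  assumes M: "sigma_finite_measure M" and id: "(\<lambda>t. t) \<in> borel_measurable M"
    and f[measurable]: "f \<in> borel_measurable M" and g[measurable]: "g \<in> borel_measurable M"
  shows "(\<integral>\<^sup>+t. f t * (\<integral>\<^sup>+s. g s * indicator {t..} s \<partial>M) * indicator {a..} t \<partial>M) =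
    (\<integral>\<^sup>+s. g s * (\<integral>\<^sup>+t. f t * indicator {a..s} t \<partial>M) * indicator {a..} s \<partial>M)"
proof -
  interpret pair_sigma_finite M M
    using M by (simp add: pair_sigma_finite_def)
  note [measurable] = borel_measurable_pair_coordinates[OF id]
  have [measurable]: "(\<lambda>s. indicator {t..} s :: ennreal) \<in> borel_measurable M"
    "(\<lambda>s. indicator {t..r} s :: ennreal) \<in> borel_measurable M" for t r :: real
    by (intro measurable_compose[OF id borel_measurable_indicator]; simp)+
  define h :: "real \<Rightarrow> real \<Rightarrow> ennreal"
    where "h t s = f t * g s * of_bool (a \<le> t \<and> t \<le> s)" for t s
  have h[measurable]: "case_prod h \<in> borel_measurable (M \<Otimes>\<^sub>M M)"
    unfolding h_def case_prod_beta by measurable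
  have "(\<integral>\<^sup>+t. f t * (\<integral>\<^sup>+s. g s * indicator {t..} s \<partial>M) * indicator {a..} t \<partial>M) =
      (\<integral>\<^sup>+t. \<integral>\<^sup>+s. h t s \<partial>M \<partial>M)"
  proof (rule nn_integral_cong)
    fix t
    have "f t * (\<integral>\<^sup>+s. g s * indicator {t..} s \<partial>M) * indicator {a..} t =
        (f t * indicator {a..} t) * (\<integral>\<^sup>+s. g s * indicator {t..} s \<partial>M)"
      by (simp add: ac_simps)
    also have "\<dots> = (\<integral>\<^sup>+s. (f t * indicator {a..} t) * (g s * indicator {t..} s) \<partial>M)"
      by (rule nn_integral_cmult[symmetric]) measurable
    also have "\<dots> = (\<integral>\<^sup>+s. h t s \<partial>M)"
      by (rule nn_integral_cong) (auto simp: h_def split: split_indicator)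
    finally show "f t * (\<integral>\<^sup>+s. g s * indicator {t..} s \<partial>M) * indicator {a..} t =
      (\<integral>\<^sup>+s. h t s \<partial>M)" .
  qed
  also have "\<dots> = (\<integral>\<^sup>+s. \<integral>\<^sup>+t. h t s \<partial>M \<partial>M)"
    by (rule Fubini'[symmetric]) measurable
  also have "\<dots> = (\<integral>\<^sup>+s. g s * (\<integral>\<^sup>+t. f t * indicator {a..s} t \<partial>M) * indicator {a..} s \<partial>M)"
  proof (rule nn_integral_cong)
    fix s
    have "g s * (\<integral>\<^sup>+t. f t * indicator {a..s} t \<partial>M) * indicator {a..} s =
        (g s * indicator {a..} s) * (\<integral>\<^sup>+t. f t * indicator {a..s} t \<partial>M)"
      by (simp add: ac_simps)
    also have "\<dots> = (\<integral>\<^sup>+t. (g s * indicator {a..} s) * (f t * indicator {a..s} t) \<partial>M)"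
      by (rule nn_integral_cmult[symmetric]) measurable
    also have "\<dots> = (\<integral>\<^sup>+t. h t s \<partial>M)"
      by (rule nn_integral_cong) (auto simp: h_def ac_simps split: split_indicator)
    finally show "(\<integral>\<^sup>+t. h t s \<partial>M) =
      g s * (\<integral>\<^sup>+t. f t * indicator {a..s} t \<partial>M) * indicator {a..} s" by simp
  qed
  finally show ?thesis .
qed

text \<open>The integrand is jointly measurable in the endpoint and the integration variable, so
  integrating out the latter leaves a measurable function. This makes the factors of the product
  weights measurable.\<close>

lemma borel_measurable_nn_integral_upto:
  fixes M :: "real measure" and f :: "real \<Rightarrow> ennreal"
  assumes M: "sigma_finite_measure M" and id: "(\<lambda>t. t) \<in> borel_measurable M"
    and f[measurable]: "f \<in> borel_measurable M"
  shows "(\<lambda>s. \<integral>\<^sup>+t. f t * indicator {a..s} t \<partial>M) \<in> borel_measurable M"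
proof -
  interpret sigma_finite_measure M by fact
  note [measurable] = borel_measurable_pair_coordinates[OF id]
  have "(\<lambda>p. f (snd p) * of_bool (a \<le> snd p \<and> snd p \<le> fst p)) \<in> borel_measurable (M \<Otimes>\<^sub>M M)"
    by measurable
  also have "(\<lambda>p. f (snd p) * of_bool (a \<le> snd p \<and> snd p \<le> fst p)) =
      (\<lambda>(s, t). f t * indicator {a..s} t)"
    by (auto simp: fun_eq_iff split: split_indicator)
  finally show ?thesis
    by (rule borel_measurable_nn_integral)
qed

lemma borel_measurable_nn_integral_from:
  fixes M :: "real measure" and f :: "real \<Rightarrow> ennreal"
  assumes M: "sigma_finite_measure M" and id: "(\<lambda>t. t) \<in> borel_measurable M"
    and f[measurable]: "f \<in> borel_measurable M"
  shows "(\<lambda>t. \<integral>\<^sup>+s. f s * indicator {t..} s \<partial>M) \<in> borel_measurable M"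
proof -
  interpret sigma_finite_measure M by fact
  note [measurable] = borel_measurable_pair_coordinates[OF id]
  have "(\<lambda>p. f (snd p) * of_bool (fst p \<le> snd p)) \<in> borel_measurable (M \<Otimes>\<^sub>M M)"
    by measurable
  also have "(\<lambda>p. f (snd p) * of_bool (fst p \<le> snd p)) = (\<lambda>(t, s). f s * indicator {t..} s)"
    by (auto simp: fun_eq_iff split: split_indicator)
  finally show ?thesis
    by (rule borel_measurable_nn_integral)
qed

text \<open>In \<open>ennreal\<close> sums and integrals can be rearranged without integrability
  conditions. The upper limit of integration is encoded in \<open>space M\<close>, so half-lines
  \<open>{\<tau>..}\<close> suffice, and the bound is assumed only at points of
  \<open>space M\<close>.\<close>

lemma nn_integral_discrete_gronwall:
  fixes M :: "real measure" and u A c :: "nat \<Rightarrow> real \<Rightarrow> ennreal" and b :: "nat \<Rightarrow> ennreal"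
  assumes M: "sigma_finite_measure M" and id: "(\<lambda>t. t) \<in> borel_measurable M"
    and A[measurable]: "\<And>k. A k \<in> borel_measurable M"
    and c[measurable]: "\<And>k. c k \<in> borel_measurable M"
    and bound: "\<And>k \<tau>. x \<le> k \<Longrightarrow> \<tau> \<in> space M \<Longrightarrow>
      u k \<tau> \<le> A k \<tau> + b k * (\<integral>\<^sup>+t. (\<Sum>l=x..<k. c l t * u l t) * indicator {\<tau>..} t \<partial>M)"
    and "x \<le> k" "\<tau> \<in> space M"
  shows "u k \<tau> \<le> A k \<tau> + b k * (\<integral>\<^sup>+t. (\<Sum>l=x..<k. c l t * A l t *
      (\<Prod>j=l+1..<k. 1 + (\<integral>\<^sup>+s. b j * c j s * indicator {\<tau>..t} s \<partial>M))) * indicator {\<tau>..} t \<partial>M)"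
  using \<open>x \<le> k\<close> \<open>\<tau> \<in> space M\<close>
proof (induction k arbitrary: \<tau> rule: less_induct)
  case (less k)
  have ind[measurable]: "(\<lambda>s. indicator {t..} s :: ennreal) \<in> borel_measurable M" for t :: real
    by (rule measurable_compose[OF id borel_measurable_indicator]) simp
  define B where "B a j s = (\<integral>\<^sup>+t. b j * c j t * indicator {a..s} t \<partial>M)" for a j s
  define P where "P a m l s = (\<Prod>j=m+1..<l. 1 + B a j s)" for a m l s
  have B_meas[measurable]: "B a j \<in> borel_measurable M" for a j
    unfolding B_def by (rule borel_measurable_nn_integral_upto[OF M id]) measurable
  have P_meas[measurable]: "P a m l \<in> borel_measurable M" for a m l
    unfolding P_def by measurable
  \<comment> \<open>Lowering the lower limit enlarges the interval of integration. The weight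
    \<open>P t m l s\<close> from the induction hypothesis at t can thus be replaced by
    \<open>P \<tau> m l s\<close>, which no longer depends on t; only then does the triangle swap
    apply.\<close>
  have P_mono: "P t m l s \<le> P \<tau> m l s" if "\<tau> \<le> t" for t m l s
    unfolding P_def B_def using that
    by (intro prod_mono_ennreal add_left_mono nn_integral_mono mult_left_mono)
      (auto split: split_indicator)
  have IH: "u l t \<le> A l t + b l *
      (\<Sum>m=x..<l. \<integral>\<^sup>+s. c m s * A m s * P \<tau> m l s * indicator {t..} s \<partial>M)"
    if l: "x \<le> l" "l < k" and t: "t \<in> space M" "\<tau> \<le> t" for l t
  proof -
    have "u l t \<le> A l t + b l *
        (\<integral>\<^sup>+s. (\<Sum>m=x..<l. c m s * A m s * P t m l s) * indicator {t..} s \<partial>M)"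
      using less.IH[OF l(2,1) t(1)] by (simp add: P_def B_def)
    also have "\<dots> \<le> A l t + b l *
        (\<integral>\<^sup>+s. (\<Sum>m=x..<l. c m s * A m s * P \<tau> m l s) * indicator {t..} s \<partial>M)"
      using P_mono[OF t(2)]
      by (intro add_left_mono mult_left_mono nn_integral_mono mult_right_mono sum_mono) auto
    also have "(\<integral>\<^sup>+s. (\<Sum>m=x..<l. c m s * A m s * P \<tau> m l s) * indicator {t..} s \<partial>M) =
        (\<Sum>m=x..<l. \<integral>\<^sup>+s. c m s * A m s * P \<tau> m l s * indicator {t..} s \<partial>M)"
      unfolding sum_distrib_right by (rule nn_integral_sum) measurable
    finally show ?thesis .
  qed
  define J where "J m l t = (\<integral>\<^sup>+s. c m s * A m s * P \<tau> m l s * indicator {t..} s \<partial>M)" for m l t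
  have [measurable]: "J m l \<in> borel_measurable M" for m l
    unfolding J_def by (rule borel_measurable_nn_integral_from[OF M id]) measurable
  have meas: "(\<lambda>t. c l t * A l t * indicator {\<tau>..} t) \<in> borel_measurable M"
    "(\<lambda>t. b l * c l t * J m l t * indicator {\<tau>..} t) \<in> borel_measurable M"
    "(\<lambda>t. c m t * A m t * P \<tau> m l t * B \<tau> l t * indicator {\<tau>..} t) \<in> borel_measurable M"
    for l m
    by measurable
  \<comment> \<open>Integral monotonicity asks only about points of \<open>space M\<close>, and the
    indicator leaves only t >= \<tau>: exactly where \<open>IH\<close> holds.\<close>
  have "(\<integral>\<^sup>+t. (\<Sum>l=x..<k. c l t * u l t) * indicator {\<tau>..} t \<partial>M)
      \<le> (\<integral>\<^sup>+t. (\<Sum>l=x..<k. c l t * (A l t + b l * (\<Sum>m=x..<l. J m l t))) * indicator {\<tau>..} t \<partial>M)"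
    using IH unfolding J_def
    by (intro nn_integral_mono)
      (auto split: split_indicator intro!: sum_mono mult_left_mono)
  also have "\<dots> = (\<integral>\<^sup>+t. (\<Sum>l=x..<k. c l t * A l t * indicator {\<tau>..} t) +
      (\<Sum>l=x..<k. \<Sum>m=x..<l. b l * c l t * J m l t * indicator {\<tau>..} t) \<partial>M)"
    by (simp only: sum_distrib_left sum_distrib_right sum.distrib distrib_left distrib_right ac_simps)
  also have "\<dots> = (\<Sum>l=x..<k. \<integral>\<^sup>+t. c l t * A l t * indicator {\<tau>..} t \<partial>M) +
      (\<Sum>l=x..<k. \<Sum>m=x..<l. \<integral>\<^sup>+t. b l * c l t * J m l t * indicator {\<tau>..} t \<partial>M)"
    by (simp only: nn_integral_add nn_integral_sum borel_measurable_sum meas)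
  \<comment> \<open>Triangle swap with f = \<open>b l * c l\<close>: the integral over t, now
    innermost, runs over [\<tau>, s] and is exactly \<open>B \<tau> l s\<close>.\<close>
  also have "(\<Sum>l=x..<k. \<Sum>m=x..<l. \<integral>\<^sup>+t. b l * c l t * J m l t * indicator {\<tau>..} t \<partial>M) =
      (\<Sum>l=x..<k. \<Sum>m=x..<l.
        \<integral>\<^sup>+s. c m s * A m s * P \<tau> m l s * B \<tau> l s * indicator {\<tau>..} s \<partial>M)"
    unfolding J_def B_def
    by (intro sum.cong refl nn_integral_triangle_swap[OF M id]) measurable
  \<comment> \<open>Grouping by m collects everything that multiplies
    \<open>c m s * A m s\<close>.\<close>
  also have "\<dots> = (\<Sum>m=x..<k. \<Sum>l=m+1..<k.
        \<integral>\<^sup>+s. c m s * A m s * P \<tau> m l s * B \<tau> l s * indicator {\<tau>..} s \<partial>M)"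
    by (rule sum_nested_swap_less)
  also have "(\<Sum>l=x..<k. \<integral>\<^sup>+t. c l t * A l t * indicator {\<tau>..} t \<partial>M) + \<dots> =
      (\<integral>\<^sup>+t. (\<Sum>m=x..<k. c m t * A m t * indicator {\<tau>..} t +
        (\<Sum>l=m+1..<k. c m t * A m t * P \<tau> m l t * B \<tau> l t * indicator {\<tau>..} t)) \<partial>M)"
    by (simp only: nn_integral_add nn_integral_sum borel_measurable_sum meas sum.distrib)
  also have "\<dots> = (\<integral>\<^sup>+t. (\<Sum>m=x..<k. c m t * A m t * P \<tau> m k t) * indicator {\<tau>..} t \<partial>M)"
  proof (intro nn_integral_cong)
    fix t
    \<comment> \<open>The term without \<open>B\<close> supplies the leading 1 of the telescoping
      sum; the terms with l > m supply the rest.\<close>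
    have telescope: "c m t * A m t * indicator {\<tau>..} t +
        (\<Sum>l=m+1..<k. c m t * A m t * P \<tau> m l t * B \<tau> l t * indicator {\<tau>..} t) =
        c m t * A m t * P \<tau> m k t * indicator {\<tau>..} t" if "m < k" for m
    proof -
      have "P \<tau> m k t = 1 + (\<Sum>l=m+1..<k. B \<tau> l t * P \<tau> m l t)"
        unfolding P_def using that by (subst one_plus_sum_prod_telescope) auto
      then show ?thesis
        by (simp only: distrib_left distrib_right sum_distrib_left sum_distrib_right mult_1_left ac_simps)
    qed
    show "(\<Sum>m=x..<k. c m t * A m t * indicator {\<tau>..} t +
        (\<Sum>l=m+1..<k. c m t * A m t * P \<tau> m l t * B \<tau> l t * indicator {\<tau>..} t)) =
        (\<Sum>m=x..<k. c m t * A m t * P \<tau> m k t) * indicator {\<tau>..} t"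
      unfolding sum_distrib_right by (intro sum.cong refl telescope) simp
  qed
  finally have "A k \<tau> + b k * (\<integral>\<^sup>+t. (\<Sum>l=x..<k. c l t * u l t) * indicator {\<tau>..} t \<partial>M) \<le>
      A k \<tau> + b k * (\<integral>\<^sup>+t. (\<Sum>m=x..<k. c m t * A m t * P \<tau> m k t) * indicator {\<tau>..} t \<partial>M)"
    by (intro add_left_mono mult_left_mono) auto
  with bound[OF less.prems] show ?case
    unfolding P_def B_def by (rule order_trans)
qed

text \<open>The integrals take values in [0, \<infinity>], so a divergent one is \<infinity> rather
  than a default real value; \<open>ennreal\<close> sets 0 times \<infinity> to 0.\<close>

theorem lemma4p1:
  fixes x :: nat
    and u A c :: "nat \<Rightarrow> real \<Rightarrow> real"
    and b :: "nat \<Rightarrow> real"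
  assumes u_nonneg: "\<And>k t. t \<in> {0..1} \<Longrightarrow> 0 \<le> u k t"
    and A_nonneg: "\<And>k t. t \<in> {0..1} \<Longrightarrow> 0 \<le> A k t"
    and c_nonneg: "\<And>k t. t \<in> {0..1} \<Longrightarrow> 0 \<le> c k t"
    and b_nonneg: "\<And>k. 0 \<le> b k"
    and u_measurable: "\<And>k. u k \<in> borel_measurable (lebesgue_on {0..1})"
    and A_measurable: "\<And>k. A k \<in> borel_measurable (lebesgue_on {0..1})"
    and c_measurable: "\<And>k. c k \<in> borel_measurable (lebesgue_on {0..1})"
    and recursive_bound: "\<And>k \<tau>. x \<le> k \<Longrightarrow> \<tau> \<in> {0<..1} \<Longrightarrow>
      ennreal (u k \<tau>) \<le> ennreal (A k \<tau>) + ennreal (b k) *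
        (\<integral>\<^sup>+t\<in>{\<tau>..1}. (\<Sum>l=x..<k. ennreal (c l t * u l t)) \<partial>lebesgue)"
  shows "\<forall>k\<ge>x. \<forall>\<tau>\<in>{0<..1}.
      ennreal (u k \<tau>) \<le> ennreal (A k \<tau>) + ennreal (b k) *
        (\<integral>\<^sup>+t\<in>{\<tau>..1}. (\<Sum>l=x..<k. ennreal (c l t * A l t) *
            (\<Prod>j=l+1..<k. 1 + (\<integral>\<^sup>+s\<in>{\<tau>..t}. ennreal (b j * c j s) \<partial>lebesgue))) \<partial>lebesgue)"
proof (intro allI impI ballI)
  fix k :: nat and \<tau> :: real
  assume k: "x \<le> k" and \<tau>: "\<tau> \<in> {0<..1}"
  \<comment> \<open>The interval is open at 0 because the recursive bound is available only for
    \<tau> > 0, while the abstract lemma asks for it at every point of the space.\<close>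
  define M :: "real measure" where "M = lebesgue_on {0<..1}"
  have space_M: "space M = {0<..1}"
    by (simp add: M_def)
  have "emeasure M (space M) \<noteq> \<infinity>"
    unfolding space_M by (simp add: M_def emeasure_restrict_space)
  then interpret finite_measure M
    by (rule finite_measureI)
  have id: "(\<lambda>t. t) \<in> borel_measurable M"
    unfolding M_def by (intro measurable_restrict_space1 measurable_completion) simp
  have meas_M: "f \<in> borel_measurable M" if "f \<in> borel_measurable (lebesgue_on {0..1})"
    for f :: "real \<Rightarrow> real"
    unfolding M_def by (rule measurable_restrict_mono[OF that]) auto
  have nn_M: "(\<integral>\<^sup>+t. f t * indicator {r..} t \<partial>M) = (\<integral>\<^sup>+t\<in>{r..1}. f t \<partial>lebesgue)"
    if "r > 0" for r and f :: "real \<Rightarrow> ennreal"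
    unfolding M_def using that
    by (subst nn_integral_restrict_space)
      (auto intro!: nn_integral_cong split: split_indicator)
  have nn_M': "(\<integral>\<^sup>+s. f s * indicator {r..t} s \<partial>M) = (\<integral>\<^sup>+s\<in>{r..t}. f s \<partial>lebesgue)"
    if "r > 0" "t \<le> 1" for r t and f :: "real \<Rightarrow> ennreal"
    unfolding M_def using that
    by (subst nn_integral_restrict_space)
      (auto intro!: nn_integral_cong split: split_indicator)
  \<comment> \<open>\<open>ennreal\<close> sends negative reals to 0, so splitting
    \<open>ennreal (c l t * u l t)\<close> into factors uses \<open>c_nonneg\<close>; the indicator
    of \<open>{\<tau>..1}\<close> keeps t in the range where it applies.\<close>
  have bound: "ennreal (u k \<tau>) \<le> ennreal (A k \<tau>) + ennreal (b k) *
      (\<integral>\<^sup>+t. (\<Sum>l=x..<k. ennreal (c l t) * ennreal (u l t)) * indicator {\<tau>..} t \<partial>M)"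
    if "x \<le> k" "\<tau> \<in> space M" for k \<tau>
  proof -
    have "(\<integral>\<^sup>+t\<in>{\<tau>..1}. (\<Sum>l=x..<k. ennreal (c l t * u l t)) \<partial>lebesgue) =
      (\<integral>\<^sup>+t\<in>{\<tau>..1}. (\<Sum>l=x..<k. ennreal (c l t) * ennreal (u l t)) \<partial>lebesgue)"
      using that c_nonneg unfolding space_M
      by (intro nn_integral_cong) (auto split: split_indicator intro!: sum.cong ennreal_mult')
    then show ?thesis
      using recursive_bound[of k \<tau>] that nn_M[of \<tau>] unfolding space_M by simp
  qed
  have "ennreal (u k \<tau>) \<le> ennreal (A k \<tau>) + ennreal (b k) *
      (\<integral>\<^sup>+t. (\<Sum>l=x..<k. ennreal (c l t) * ennreal (A l t) * (\<Prod>j=l+1..<k. 1 +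
        (\<integral>\<^sup>+s. ennreal (b j) * ennreal (c j s) * indicator {\<tau>..t} s \<partial>M))) * indicator {\<tau>..} t \<partial>M)"
    using k \<tau> meas_M[OF A_measurable] meas_M[OF c_measurable]
    by (intro nn_integral_discrete_gronwall[where u="\<lambda>k t. ennreal (u k t)"] bound id
        sigma_finite_measure_axioms measurable_compose[OF _ measurable_ennreal])
      (auto simp: space_M)
  \<comment> \<open>The outer integral is rewritten first: its indicator then gives t <= 1, which
    \<open>nn_M'\<close> requires for the inner integrals over \<open>{\<tau>..t}\<close>.\<close>
  also have "(\<integral>\<^sup>+t. (\<Sum>l=x..<k. ennreal (c l t) * ennreal (A l t) * (\<Prod>j=l+1..<k. 1 +
        (\<integral>\<^sup>+s. ennreal (b j) * ennreal (c j s) * indicator {\<tau>..t} s \<partial>M))) * indicator {\<tau>..} t \<partial>M)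
    = (\<integral>\<^sup>+t\<in>{\<tau>..1}. (\<Sum>l=x..<k. ennreal (c l t * A l t) *
        (\<Prod>j=l+1..<k. 1 + (\<integral>\<^sup>+s\<in>{\<tau>..t}. ennreal (b j * c j s) \<partial>lebesgue))) \<partial>lebesgue)"
    using \<tau> c_nonneg b_nonneg
    by (subst nn_M)
      (auto simp: nn_M' ennreal_mult' intro!: nn_integral_cong sum.cong split: split_indicator)
  finally show "ennreal (u k \<tau>) \<le> ennreal (A k \<tau>) + ennreal (b k) *
      (\<integral>\<^sup>+t\<in>{\<tau>..1}. (\<Sum>l=x..<k. ennreal (c l t * A l t) *
        (\<Prod>j=l+1..<k. 1 + (\<integral>\<^sup>+s\<in>{\<tau>..t}. ennreal (b j * c j s) \<partial>lebesgue))) \<partial>lebesgue)" .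
qed

end
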